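(* Let $q:=\min\{k\in[0,T-1]:\delta_k=0\}$. Then $$\emptyset\ne\mathcal E\Big(\sum_{i=0}^{q}\delta_i\Big)=\mathcal E\Big(q,\sum_{i=0}^{q}\delta_i\Big).$$
   Context: Fix integers $m,p\ge 1$ and $T\ge 1$; $[i,j]$ denotes the integers from $i$ to $j$. Matrices with zero rows or columns are allowed (the product of an $a\times 0$ and a $0\times b$ matrix is the zero $a\times b$ matrix; void matrices have rank $0$). Systems. For $n\ge 0$, a system with $n$ states is a matrix $\begin{bmatrix}A&B\\C&D\end{bmatrix}\in\mathbb R^{(n+p)\times(n+m)}$ with $A\in\mathbb R^{n\times n}$, $B\in\mathbb R^{n\times m}$, $C\in\mathbb R^{p\times n}$, $D\in\mathbb R^{p\times m}$, representing $x(t+1)=Ax(t)+Bu(t)$, $y(t)=Cx(t)+Du(t)$. Let $\Omega_{-1}$ be the $0\times n$ matrix and, for $k\ge 0$, let $\Omega_k$ be the matrix obtained by stacking $C,CA,\dots,CA^k$. The lag $\ell(C,A)$ is the smallest integer $k\ge 0$ with $\operatorname{rank}\Omega_k=\operatorname{rank}\Omega_{k-1}$. $\mathcal S(\ell,n)$ is the set of systems with $n$ states and lag $\ell$; $\mathcal S(n)=\bigcup_{\ell\in[0,n]}\mathcal S(\ell,n)$. A system is minimal if $(C,A)$ is observable and $(A,B)$ is controllable (for $n=0$ both hold by convention). Data. $u_{[0,T-1]}=[u_0\ \cdots\ u_{T-1}]\in\mathbb R^{m\times T}$ and $y_{[0,T-1]}=[y_0\ \cdots\ y_{T-1}]\in\mathbb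 R^{p\times T}$, with $u_{[0,T-1]}\ne 0$. A system in $\mathcal S(n)$ explains the data if there is $x_{[0,T]}=[x_0\ \cdots\ x_T]\in\mathbb R^{n\times(T+1)}$ with $x_{t+1}=Ax_t+Bu_t$ and $y_t=Cx_t+Du_t$ for all $t\in[0,T-1]$. $\mathcal E(n)$ is the set of systems in $\mathcal S(n)$ explaining the data and $\mathcal E(\ell,n)$ the set of those in $\mathcal S(\ell,n)$. The data are generated by (i.e. explained by) some minimal "true" system. Hankel matrices and $\delta_k$. For $k\in[0,T-1]$, $H_k=\begin{bmatrix}H_k(u_{[0,T-1]})\\H_k(y_{[0,T-1]})\end{bmatrix}\in\mathbb R^{(k+1)(m+p)\times(T-k)}$, where $H_k(f_{[0,T-1]})$ is the block Hankel matrix whose $(i,j)$ block, $i\in[0,k]$, $j\in[0,T-k-1]$, is $f_{i+j}$; $G_k$ is $H_k$ with its last $p$ rows deleted. $\delta_{-1}:=p$ and $\delta_k:=\operatorname{rank}H_k-\operatorname{rank}G_k$ for $k\in[0,T-1]$. Since $u_{[0,T-1]}\neq0$, $\delta_{T-1}=0$, so $q$ is well defined. *)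

theory Defs
  imports "Jordan_Normal_Form.DL_Rank"
begin

text \<open>Matrices are taken from \<^theory>\<open>Jordan_Normal_Form.Matrix\<close>, where dimensions are
  values and may be zero. Void matrices have rank 0, as the span of their columns is trivial.\<close>

definition mat_rank :: "real mat \<Rightarrow> nat" where
  "mat_rank M = vec_space.rank (dim_row M) M"

subsection \<open>Systems\<close>

text \<open>\<open>obs_mat C A k\<close> stacks the \<open>k\<close> blocks \<open>C, C A, \<dots>, C A^(k-1)\<close>. Hence it is \<open>\<Omega>\<close> with index
  \<open>k - 1\<close>, and \<open>obs_mat C A 0\<close>, the matrix without rows, is \<open>\<Omega>\<close> with index \<open>-1\<close>.\<close>

definition obs_mat :: "real mat \<Rightarrow> real mat \<Rightarrow> nat \<Rightarrow> real mat" where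
  "obs_mat C A k = mat (k * dim_row C) (dim_col C)
     (\<lambda>(i, j). (C * A ^\<^sub>m (i div dim_row C)) $$ (i mod dim_row C, j))"

definition lag :: "real mat \<Rightarrow> real mat \<Rightarrow> nat" where
  "lag C A = (LEAST k. mat_rank (obs_mat C A (k + 1)) = mat_rank (obs_mat C A k))"

text \<open>\<open>ctrb_mat A B k\<close> is the block row \<open>B, A B, \<dots>, A^(k-1) B\<close>.\<close>

definition ctrb_mat :: "real mat \<Rightarrow> real mat \<Rightarrow> nat \<Rightarrow> real mat" where
  "ctrb_mat A B k = mat (dim_row B) (k * dim_col B)
     (\<lambda>(i, j). (A ^\<^sub>m (j div dim_col B) * B) $$ (i, j mod dim_col B))"

text \<open>Kalman's rank conditions; both hold trivially if there are no states.\<close>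

definition observable :: "real mat \<Rightarrow> real mat \<Rightarrow> bool" where
  "observable C A \<longleftrightarrow> mat_rank (obs_mat C A (dim_row A)) = dim_row A"

definition controllable :: "real mat \<Rightarrow> real mat \<Rightarrow> bool" where
  "controllable A B \<longleftrightarrow> mat_rank (ctrb_mat A B (dim_row A)) = dim_row A"

definition system_blocks ::
  "nat \<Rightarrow> nat \<Rightarrow> nat \<Rightarrow> real mat \<Rightarrow> real mat \<Rightarrow> real mat \<Rightarrow> real mat \<Rightarrow> real mat \<Rightarrow> bool" where
  "system_blocks m p n M A B C D \<longleftrightarrow>
     A \<in> carrier_mat n n \<and> B \<in> carrier_mat n m \<and> C \<in> carrier_mat p n \<and> D \<in> carrier_mat p m \<and>
     M = four_block_mat A B C D"

definition systems_lag :: "nat \<Rightarrow> nat \<Rightarrow> nat \<Rightarrow> nat \<Rightarrow> real mat set" where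
  "systems_lag m p l n = {M. \<exists>A B C D. system_blocks m p n M A B C D \<and> lag C A = l}"

definition systems :: "nat \<Rightarrow> nat \<Rightarrow> nat \<Rightarrow> real mat set" where
  "systems m p n = (\<Union>l\<in>{0..n}. systems_lag m p l n)"

definition minimal_system :: "nat \<Rightarrow> nat \<Rightarrow> nat \<Rightarrow> real mat \<Rightarrow> bool" where
  "minimal_system m p n M \<longleftrightarrow>
     (\<exists>A B C D. system_blocks m p n M A B C D \<and> observable C A \<and> controllable A B)"

subsection \<open>Data\<close>

text \<open>The data are matrices \<open>u\<close> and \<open>y\<close> whose columns \<open>0, \<dots>, T - 1\<close> are the samples; thus
  \<open>m = dim_row u\<close>, \<open>p = dim_row y\<close> and \<open>T = dim_col u = dim_col y\<close>.\<close>

definition explains :: "real mat \<Rightarrow> real mat \<Rightarrow> nat \<Rightarrow> real mat \<Rightarrow> bool" where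
  "explains u y n M \<longleftrightarrow>
     (\<exists>A B C D x. system_blocks (dim_row u) (dim_row y) n M A B C D \<and>
        x \<in> carrier_mat n (dim_col u + 1) \<and>
        (\<forall>t < dim_col u.
           col x (t + 1) = A *\<^sub>v col x t + B *\<^sub>v col u t \<and>
           col y t = C *\<^sub>v col x t + D *\<^sub>v col u t))"

definition explaining :: "real mat \<Rightarrow> real mat \<Rightarrow> nat \<Rightarrow> real mat set" where
  "explaining u y n = {M \<in> systems (dim_row u) (dim_row y) n. explains u y n M}"

definition explaining_lag :: "real mat \<Rightarrow> real mat \<Rightarrow> nat \<Rightarrow> nat \<Rightarrow> real mat set" where
  "explaining_lag u y l n = {M \<in> systems_lag (dim_row u) (dim_row y) l n. explains u y n M}"

subsection \<open>Hankel matrices\<close>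

text \<open>The following are meant for \<open>k < T\<close> only. Row \<open>i\<close> of a block Hankel matrix with blocks of \<open>r\<close>
  rows is row \<open>i mod r\<close> of block row \<open>i div r\<close>.\<close>

definition block_hankel :: "nat \<Rightarrow> real mat \<Rightarrow> real mat" where
  "block_hankel k f = mat ((k + 1) * dim_row f) (dim_col f - k)
     (\<lambda>(i, j). f $$ (i mod dim_row f, i div dim_row f + j))"

definition H_mat :: "real mat \<Rightarrow> real mat \<Rightarrow> nat \<Rightarrow> real mat" where
  "H_mat u y k = block_hankel k u @\<^sub>r block_hankel k y"

definition G_mat :: "real mat \<Rightarrow> real mat \<Rightarrow> nat \<Rightarrow> real mat" where
  "G_mat u y k = mat (dim_row (H_mat u y k) - dim_row y) (dim_col (H_mat u y k))
     (\<lambda>(i, j). H_mat u y k $$ (i, j))"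

text \<open>The subtraction does not truncate, as deleting rows does not increase the rank.\<close>

definition delta :: "real mat \<Rightarrow> real mat \<Rightarrow> nat \<Rightarrow> nat" where
  "delta u y k = mat_rank (H_mat u y k) - mat_rank (G_mat u y k)"

end

theory Submission
  imports Defs
begin

text \<open>Order the rows of a Hankel matrix with the inputs first and then by time and output index.
  The number \<open>\<delta>\<^sub>k\<close> counts the outputs \<open>a\<close> whose sample at time \<open>t + k\<close> is not, uniformly in \<open>t\<close>, a
  combination of the preceding rows. Shifting a relation in time gives one of the next order, so each
  output has an index \<open>\<kappa>\<^sub>a\<close> from which on it is dependent; all indices are at most \<open>q\<close> and
  \<open>\<Sum>\<delta>\<^sub>i = \<Sum>\<kappa>\<^sub>a\<close>.

  Lag: a linear relation among the rows of \<open>C, CA, \<dots>, CA\<^sup>k\<close> of an explaining system yields one among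
  the data, so \<open>\<delta>\<^sub>k\<close> is at most the rank increment of the observability matrix at \<open>k\<close>. These
  increments add up to at most the number of states, so with \<open>\<Sum>\<delta>\<^sub>i\<close> states they equal \<open>\<delta>\<^sub>k\<close> for
  \<open>k \<le> q\<close>, and \<open>q\<close> is the lag.

  Existence: the \<open>\<kappa>\<^sub>a\<close> relations form a difference equation whose leading coefficient matrix is
  unit lower triangular; its observer form has \<open>\<Sum>\<kappa>\<^sub>a\<close> states.\<close>

subsection \<open>Rank as the number of rows independent of their predecessors\<close>

text \<open>Gaussian elimination by induction on the equations: an equation with a nonzero
  coefficient eliminates one unknown, so the unknowns stay in excess.\<close>

lemma homogeneous_nontrivial_solution:
  fixes f :: "'i \<Rightarrow> 'j \<Rightarrow> 'a::field"
  assumes "finite I" "finite J" "card I < card J"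
  shows "\<exists>c. (\<exists>j\<in>J. c j \<noteq> 0) \<and> (\<forall>i\<in>I. (\<Sum>j\<in>J. c j * f i j) = 0)"
  using assms
proof (induction I arbitrary: J f rule: finite_induct)
  case empty
  then obtain j where "j \<in> J" by fastforce
  then show ?case by (intro exI[of _ "\<lambda>_. 1"]) auto
next
  case (insert i0 I)
  show ?case
  proof (cases "\<forall>j\<in>J. f i0 j = 0")
    case True
    then have *: "(\<Sum>j\<in>J. c j * f i0 j) = 0" for c by (intro sum.neutral) auto
    have "card I < card J" using insert by simp
    with insert.IH[OF \<open>finite J\<close>] * show ?thesis by (metis insert_iff)
  next
    case False
    then obtain j0 where j0: "j0 \<in> J" "f i0 j0 \<noteq> 0" by auto
    \<comment> \<open>Coefficients left after the unknown \<open>j0\<close> is eliminated by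
      equation \<open>i0\<close>.\<close>
    define g where "g i j = f i j - f i j0 * f i0 j / f i0 j0" for i j
    have "card I < card (J - {j0})" using insert j0 by simp
    with insert.IH[of "J - {j0}" g] \<open>finite J\<close> obtain c where
      c: "\<exists>j\<in>J - {j0}. c j \<noteq> 0" "\<forall>i\<in>I. (\<Sum>j\<in>J - {j0}. c j * g i j) = 0" by blast
    define s where "s = (\<Sum>j\<in>J - {j0}. c j * f i0 j)"
    \<comment> \<open>Back substitution: the value at \<open>j0\<close> is the one that solves
      equation \<open>i0\<close>.\<close>
    define d where "d = c(j0 := - s / f i0 j0)"
    have split: "(\<Sum>j\<in>J. d j * f i j) = - s / f i0 j0 * f i j0 + (\<Sum>j\<in>J - {j0}. c j * f i j)" for i
      using sum.remove[OF \<open>finite J\<close> j0(1), of "\<lambda>j. d j * f i j"] by (simp add: d_def)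
    have g: "(\<Sum>j\<in>J - {j0}. c j * g i j) = (\<Sum>j\<in>J - {j0}. c j * f i j) - f i j0 / f i0 j0 * s" for i
      unfolding g_def s_def by (simp add: sum_distrib_left sum_subtractf algebra_simps)
    have "(\<Sum>j\<in>J. d j * f i j) = 0" if "i \<in> I" for i
    proof -
      have "(\<Sum>j\<in>J - {j0}. c j * f i j) = f i j0 / f i0 j0 * s" using c(2) that g[of i] by simp
      then show ?thesis unfolding split by simp
    qed
    moreover have "(\<Sum>j\<in>J. d j * f i0 j) = 0"
      using j0(2) unfolding split s_def by simp
    moreover have "\<exists>j\<in>J. d j \<noteq> 0" using c(1) by (auto simp: d_def)
    ultimately show ?thesis by blast
  qed
qed

text \<open>Bridge from rank in terms of sets of column vectors to sums over column indices: a
  maximal independent set of columns is independent and spans all columns.\<close>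

lemma mat_rank_column_basis:
  obtains J where "finite J" "card J = mat_rank M" "J \<subseteq> {..<dim_col M}"
    "\<And>c. \<forall>i<dim_row M. (\<Sum>j\<in>J. c j * M $$ (i, j)) = 0 \<Longrightarrow> \<forall>j\<in>J. c j = 0"
    "\<And>k. k < dim_col M \<Longrightarrow> \<exists>c. \<forall>i<dim_row M. M $$ (i, k) = (\<Sum>j\<in>J. c j * M $$ (i, j))"
proof -
  interpret vec_space "TYPE(real)" "dim_row M" .
  have M: "M \<in> carrier_mat (dim_row M) (dim_col M)" by simp
  have carr: "set (cols M) \<subseteq> carrier_vec (dim_row M)" using cols_dim by blast
  define Ind where "Ind T \<longleftrightarrow> T \<subseteq> set (cols M) \<and> lin_indpt T" for T
  have "Ind {}" unfolding Ind_def lin_dep_def by auto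
  then obtain S where S: "finite S" "maximal S Ind"
    using maximal_exists_superset[of "set (cols M)" Ind "{}"] unfolding Ind_def by auto
  have rank: "mat_rank M = card S"
    using rank_card_indpt[OF M] S(2) unfolding mat_rank_def Ind_def by simp
  have Scols: "S \<subseteq> set (cols M)" and Sli: "lin_indpt S"
    using S(2) unfolding maximal_def Ind_def by auto
  have Scarr: "S \<subseteq> carrier_vec (dim_row M)" using Scols carr by (rule subset_trans)
  \<comment> \<open>A vector may occur as several columns, so one index is picked for each vector of
    \<open>S\<close>; \<open>ix\<close> is injective because the column at \<open>ix v\<close> is
    \<open>v\<close>.\<close>
  have "\<forall>v\<in>S. \<exists>j<dim_col M. col M j = v"
    using Scols by (metis cols_length cols_nth in_set_conv_nth subsetD)
  then obtain ix where ix: "\<And>v. v \<in> S \<Longrightarrow> ix v < dim_col M \<and> col M (ix v) = v" by metis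
  have inj: "inj_on ix S" by (metis ix inj_onI)
  have lc: "(\<Sum>j\<in>ix ` S. c j * M $$ (i, j)) = lincomb (c \<circ> ix) S $ i" if "i < dim_row M" for c i
  proof -
    have "(\<Sum>j\<in>ix ` S. c j * M $$ (i, j)) = (\<Sum>v\<in>S. c (ix v) * v $ i)"
      unfolding sum.reindex[OF inj] using ix that
      by (intro sum.cong) (auto simp: index_col[symmetric] simp del: index_col)
    then show ?thesis using lincomb_index[OF that Scarr] by simp
  qed
  show thesis
  proof (rule that[of "ix ` S"])
    show "finite (ix ` S)" "ix ` S \<subseteq> {..<dim_col M}" using S(1) ix by auto
    show "card (ix ` S) = mat_rank M" using rank card_image[OF inj] by simp
  next
    fix c assume c: "\<forall>i<dim_row M. (\<Sum>j\<in>ix ` S. c j * M $$ (i, j)) = 0"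
    have "lincomb (c \<circ> ix) S = 0\<^sub>v (dim_row M)"
      using c lc lincomb_dim[OF S(1) Scarr] by (intro eq_vecI) auto
    then show "\<forall>j\<in>ix ` S. c j = 0"
      using not_lindepD[OF Sli S(1) subset_refl, of "c \<circ> ix"] by (auto simp: class_ring_simps)
  next
    fix k assume k: "k < dim_col M"
    have "col M k \<in> span S"
    proof (cases "col M k \<in> S")
      case True
      then show ?thesis using span_mem[OF Scarr] by blast
    next
      case False
      have kc: "col M k \<in> set (cols M)" using k by (metis cols_length cols_nth nth_mem)
      \<comment> \<open>By maximality, adjoining \<open>col M k\<close> destroys independence; as
        \<open>S\<close> itself is independent, \<open>col M k\<close> lies in its span.\<close>
      have "\<not> Ind (insert (col M k) S)"
        using S(2) False unfolding maximal_def by blast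
      then have "lin_dep (S \<union> {col M k})" using kc Scols unfolding Ind_def by auto
      then show ?thesis
        using lin_dep_iff_in_span[OF Scarr Sli _ False] kc carr by blast
    qed
    then obtain a where "col M k = lincomb a S"
      unfolding finite_span[OF S(1) Scarr] by auto
    then have a: "\<And>i. i < dim_row M \<Longrightarrow> M $$ (i, k) = lincomb a S $ i"
      using k by (metis index_col)
    have "lincomb (a \<circ> the_inv_into S ix \<circ> ix) S = lincomb a S"
      by (intro lincomb_cong refl Scarr) (auto simp: the_inv_into_f_f[OF inj])
    then show "\<exists>c. \<forall>i<dim_row M. M $$ (i, k) = (\<Sum>j\<in>ix ` S. c j * M $$ (i, j))"
      using a lc[of _ "a \<circ> the_inv_into S ix"] by (intro exI[of _ "a \<circ> the_inv_into S ix"]) simp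
  qed
qed

text \<open>The rows without this property are those that a greedy pass from the top keeps; they
  form a basis of the row space.\<close>

definition row_dep :: "real mat \<Rightarrow> nat \<Rightarrow> bool" where
  "row_dep M i \<longleftrightarrow> (\<exists>c. \<forall>j<dim_col M. M $$ (i, j) = (\<Sum>l<i. c l * M $$ (l, j)))"

text \<open>A dependent row is replaced by its predecessors, which are combinations of the kept rows
  by strong induction.\<close>

lemma row_in_span_independent_rows:
  assumes "i < dim_row M"
  shows "\<exists>c. \<forall>j<dim_col M. M $$ (i, j) = (\<Sum>l | l < dim_row M \<and> \<not> row_dep M l. c l * M $$ (l, j))"
  using assms
proof (induction i rule: less_induct)
  case (less i)
  let ?S = "{l. l < dim_row M \<and> \<not> row_dep M l}"
  show ?case
  proof (cases "row_dep M i")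
    case False
    then have "i \<in> ?S" using less.prems by simp
    then have "(\<Sum>l\<in>?S. (if l = i then 1 else 0) * M $$ (l, j)) = M $$ (i, j)" for j
      by (subst sum.remove[of _ i]) auto
    then show ?thesis by (intro exI[of _ "\<lambda>l. if l = i then 1 else 0"]) simp
  next
    case True
    then obtain d where d: "\<And>j. j < dim_col M \<Longrightarrow> M $$ (i, j) = (\<Sum>l<i. d l * M $$ (l, j))"
      unfolding row_dep_def by blast
    have "\<forall>l. \<exists>c. l < i \<longrightarrow> (\<forall>j<dim_col M. M $$ (l, j) = (\<Sum>l\<in>?S. c l * M $$ (l, j)))"
      using less.IH less.prems by (meson less_trans)
    from choice[OF this] obtain e where e: "\<And>l j. l < i \<Longrightarrow> j < dim_col M \<Longrightarrow>
        M $$ (l, j) = (\<Sum>l'\<in>?S. e l l' * M $$ (l', j))"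
      by blast
    have "M $$ (i, j) = (\<Sum>l'\<in>?S. (\<Sum>l<i. d l * e l l') * M $$ (l', j))" if "j < dim_col M" for j
    proof -
      have "M $$ (i, j) = (\<Sum>l<i. \<Sum>l'\<in>?S. d l * e l l' * M $$ (l', j))"
        unfolding d[OF that] by (intro sum.cong refl) (simp add: e that sum_distrib_left mult.assoc)
      then show ?thesis unfolding sum_distrib_right by (subst sum.swap)
    qed
    then show ?thesis by (intro exI[of _ "\<lambda>l'. \<Sum>l<i. d l * e l l'"]) blast
  qed
qed

text \<open>In a nontrivial relation, the row of largest index with a nonzero coefficient would be a
  combination of its predecessors.\<close>

lemma independent_rows:
  assumes "finite S" "\<And>i. i \<in> S \<Longrightarrow> \<not> row_dep M i"
    and "\<forall>j<dim_col M. (\<Sum>i\<in>S. c i * M $$ (i, j)) = 0"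
  shows "\<forall>i\<in>S. c i = 0"
proof (rule ccontr)
  assume neg: "\<not> ?thesis"
  define i where "i = Max {i \<in> S. c i \<noteq> 0}"
  have fin: "finite {i \<in> S. c i \<noteq> 0}" and "{i \<in> S. c i \<noteq> 0} \<noteq> {}"
    using assms(1) neg by auto
  then have i: "i \<in> S" "c i \<noteq> 0" using Max_in unfolding i_def by blast+
  have big: "c l = 0" if "l \<in> S" "l > i" for l
    using Max_ge[OF fin, of l] that unfolding i_def by force
  \<comment> \<open>The relation solved for row \<open>i\<close>; predecessors outside
    \<open>S\<close> receive coefficient 0.\<close>
  have "M $$ (i, j) = (\<Sum>l<i. (if l \<in> S then - c l / c i else 0) * M $$ (l, j))" if "j < dim_col M" for j
  proof -
    have "0 = (\<Sum>l\<in>S. c l * M $$ (l, j))" using assms(3) that by simp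
    also have "\<dots> = c i * M $$ (i, j) + (\<Sum>l\<in>S - {i}. c l * M $$ (l, j))"
      by (rule sum.remove[OF assms(1) i(1)])
    also have "(\<Sum>l\<in>S - {i}. c l * M $$ (l, j)) = (\<Sum>l\<in>S \<inter> {..<i}. c l * M $$ (l, j))"
      using assms(1) big by (intro sum.mono_neutral_right) (auto, metis nat_neq_iff)
    also have "\<dots> = (\<Sum>l<i. if l \<in> S then c l * M $$ (l, j) else 0)"
      by (simp add: Int_commute flip: sum.inter_restrict)
    finally have "M $$ (i, j) = - (\<Sum>l<i. if l \<in> S then c l * M $$ (l, j) else 0) / c i"
      using i(2) by (simp add: field_simps)
    also have "\<dots> = (\<Sum>l<i. (if l \<in> S then - c l / c i else 0) * M $$ (l, j))"
      unfolding sum_negf[symmetric] sum_divide_distrib by (intro sum.cong) auto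
    finally show ?thesis .
  qed
  then have "row_dep M i" unfolding row_dep_def by (intro exI[of _ "\<lambda>l. if l \<in> S then - c l / c i else 0"]) blast
  then show False using assms(2) i(1) by blast
qed

text \<open>Row rank equals column rank: a basis of columns and the greedy basis of rows determine each
  other's linear relations, so neither can have more elements than the other.\<close>

lemma mat_rank_card_rows: "mat_rank M = card {i. i < dim_row M \<and> \<not> row_dep M i}"
proof -
  let ?S = "{i. i < dim_row M \<and> \<not> row_dep M i}"
  obtain J where J: "finite J" "card J = mat_rank M" "J \<subseteq> {..<dim_col M}"
    and ind: "\<And>c. \<forall>i<dim_row M. (\<Sum>j\<in>J. c j * M $$ (i, j)) = 0 \<Longrightarrow> \<forall>j\<in>J. c j = 0"
    and span: "\<And>k. k < dim_col M \<Longrightarrow> \<exists>c. \<forall>i<dim_row M. M $$ (i, k) = (\<Sum>j\<in>J. c j * M $$ (i, j))"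
    by (rule mat_rank_column_basis[of M]) (rule that)
  have "\<not> card ?S < card J"
  proof
    assume "card ?S < card J"
    then obtain c where c: "\<exists>j\<in>J. c j \<noteq> 0" "\<forall>i\<in>?S. (\<Sum>j\<in>J. c j * M $$ (i, j)) = 0"
      using homogeneous_nontrivial_solution[of ?S J "\<lambda>i j. M $$ (i, j)"] J(1) by auto
    have "(\<Sum>j\<in>J. c j * M $$ (i, j)) = 0" if i: "i < dim_row M" for i
    proof -
      obtain d where d: "\<And>j. j < dim_col M \<Longrightarrow> M $$ (i, j) = (\<Sum>l\<in>?S. d l * M $$ (l, j))"
        using row_in_span_independent_rows[OF i] by blast
      have "(\<Sum>j\<in>J. c j * M $$ (i, j)) = (\<Sum>j\<in>J. \<Sum>l\<in>?S. d l * (c j * M $$ (l, j)))"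
        using J(3) by (intro sum.cong refl) (auto simp: d sum_distrib_left mult_ac)
      also have "\<dots> = (\<Sum>l\<in>?S. d l * (\<Sum>j\<in>J. c j * M $$ (l, j)))"
        by (subst sum.swap) (simp add: sum_distrib_left)
      also have "\<dots> = 0" using c(2) by (intro sum.neutral) auto
      finally show ?thesis .
    qed
    then show False using ind c(1) by blast
  qed
  moreover have "\<not> card J < card ?S"
  proof
    assume "card J < card ?S"
    then obtain c where c: "\<exists>i\<in>?S. c i \<noteq> 0" "\<forall>j\<in>J. (\<Sum>i\<in>?S. c i * M $$ (i, j)) = 0"
      using homogeneous_nontrivial_solution[of J ?S "\<lambda>j i. M $$ (i, j)"] J(1) by auto
    have "(\<Sum>i\<in>?S. c i * M $$ (i, k)) = 0" if k: "k < dim_col M" for k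
    proof -
      obtain d where d: "\<And>i. i < dim_row M \<Longrightarrow> M $$ (i, k) = (\<Sum>j\<in>J. d j * M $$ (i, j))"
        using span[OF k] by blast
      have "(\<Sum>i\<in>?S. c i * M $$ (i, k)) = (\<Sum>i\<in>?S. \<Sum>j\<in>J. d j * (c i * M $$ (i, j)))"
        by (intro sum.cong refl) (auto simp: d sum_distrib_left mult_ac)
      also have "\<dots> = (\<Sum>j\<in>J. d j * (\<Sum>i\<in>?S. c i * M $$ (i, j)))"
        by (subst sum.swap) (simp add: sum_distrib_left)
      also have "\<dots> = 0" using c(2) by (intro sum.neutral) auto
      finally show ?thesis .
    qed
    then have "\<forall>i\<in>?S. c i = 0" by (intro independent_rows[of ?S M]) simp_all
    then show False using c(1) by blast
  qed
  ultimately show ?thesis using J(2) by simp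
qed

subsection \<open>Relations in the Hankel matrices\<close>

text \<open>The base rows \<open>U\<close> come first, followed by blocks of \<open>p\<close> rows; row \<open>a\<close> of block \<open>k\<close> is the last
  one of the relation.\<close>

definition lead_dep :: "nat \<Rightarrow> nat \<Rightarrow> (nat \<Rightarrow> nat \<Rightarrow> real) \<Rightarrow> nat \<Rightarrow> (nat \<Rightarrow> nat \<Rightarrow> nat \<Rightarrow> real) \<Rightarrow> nat \<Rightarrow> nat \<Rightarrow> bool" where
  "lead_dep N L U p V k a \<longleftrightarrow> (\<exists>P d. P k a = 1 \<and> (\<forall>b. a < b \<and> b < p \<longrightarrow> P k b = 0) \<and>
     (\<forall>j<N. (\<Sum>s\<le>k. \<Sum>b<p. P s b * V s b j) + (\<Sum>l<L. d l * U l j) = 0))"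

section \<open>Flat row indices and block indices\<close>

lemma sum_blocks:
  fixes f :: "nat \<Rightarrow> 'a::comm_monoid_add"
  shows "(\<Sum>i<n * p. f i) = (\<Sum>s<n. \<Sum>b<p. f (s * p + b))"
proof -
  have "(\<Sum>b<p. f (s * p + b)) = sum f {s * p..<s * p + p}" for s
    by (rule sum.reindex_bij_witness[of _ "\<lambda>i. i - s * p" "\<lambda>b. s * p + b"]) auto
  then show ?thesis by (simp add: sum.nat_group)
qed

lemma block_index_less: "(s::nat) < n \<Longrightarrow> b < p \<Longrightarrow> s * p + b < n * p"
proof -
  assume "s < n" "b < p"
  then have "s * p + b < (s + 1) * p" by simp
  also have "\<dots> \<le> n * p" using \<open>s < n\<close> by (intro mult_right_mono) auto
  finally show ?thesis .
qed

text \<open>The dependent row is moved to the side of its predecessors with coefficient 1. The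
  vanishing coefficients \<open>P k b\<close> for \<open>b > a\<close> make the sum over complete
  blocks stop at exactly this row.\<close>

lemma row_dep_iff_lead_dep:
  assumes a: "a < p"
    and U: "\<And>l j. l < L \<Longrightarrow> j < dim_col M \<Longrightarrow> M $$ (l, j) = U l j"
    and V: "\<And>s b j. s \<le> k \<Longrightarrow> b < p \<Longrightarrow> j < dim_col M \<Longrightarrow> M $$ (L + (s * p + b), j) = V s b j"
  shows "row_dep M (L + (k * p + a)) \<longleftrightarrow> lead_dep (dim_col M) L U p V k a"
proof -
  let ?i = "k * p + a"
  have last: "(\<Sum>s\<le>k. \<Sum>b<p. P s b * V s b j) =
      (\<Sum>i<?i. P (i div p) (i mod p) * M $$ (L + i, j)) + M $$ (L + ?i, j)"
    if P: "P k a = 1" "\<forall>b. a < b \<and> b < p \<longrightarrow> P k b = 0" and j: "j < dim_col M" for P j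
  proof -
    let ?g = "\<lambda>i. P (i div p) (i mod p) * M $$ (L + i, j)"
    have "(\<Sum>s\<le>k. \<Sum>b<p. P s b * V s b j) = (\<Sum>s<Suc k. \<Sum>b<p. ?g (s * p + b))"
      unfolding lessThan_Suc_atMost using V j by (intro sum.cong refl) auto
    also have "\<dots> = (\<Sum>i<Suc k * p. ?g i)" by (rule sum_blocks[symmetric])
    also have "\<dots> = (\<Sum>i<Suc ?i. ?g i)"
    proof (rule sum.mono_neutral_right)
      show "{..<Suc ?i} \<subseteq> {..<Suc k * p}" using a by auto
      show "\<forall>i\<in>{..<Suc k * p} - {..<Suc ?i}. ?g i = 0"
      proof
        fix i assume i: "i \<in> {..<Suc k * p} - {..<Suc ?i}"
        define b where "b = i - k * p"
        have "i = k * p + b" "a < b" "b < p" using i by (auto simp: b_def)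
        then show "?g i = 0" using P(2) by simp
      qed
    qed simp
    finally show ?thesis using P(1) a by simp
  qed
  have first: "(\<Sum>l<L + n. c l * M $$ (l, j)) = (\<Sum>l<L. c l * U l j) + (\<Sum>i<n. c (L + i) * M $$ (L + i, j))"
    if "j < dim_col M" for c n j
  proof -
    have "(\<Sum>l<L + n. c l * M $$ (l, j)) = (\<Sum>l<L. c l * M $$ (l, j)) + (\<Sum>i<n. c (L + i) * M $$ (L + i, j))"
      by (induction n) (auto simp: add.assoc)
    then show ?thesis using U that by simp
  qed
  show ?thesis
  proof
    assume "row_dep M (L + ?i)"
    then obtain c where c: "\<And>j. j < dim_col M \<Longrightarrow> M $$ (L + ?i, j) = (\<Sum>l<L + ?i. c l * M $$ (l, j))"
      unfolding row_dep_def by blast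
    \<comment> \<open>Predecessors get the negated coefficient, the row itself gets 1, and later
      rows get 0.\<close>
    define P where "P s b = (if s * p + b < ?i then - c (L + (s * p + b)) else if s * p + b = ?i then 1 else 0)" for s b
    have P: "P k a = 1" "\<forall>b. a < b \<and> b < p \<longrightarrow> P k b = 0" by (auto simp: P_def)
    have rel: "(\<Sum>s\<le>k. \<Sum>b<p. P s b * V s b j) + (\<Sum>l<L. - c l * U l j) = 0" if j: "j < dim_col M" for j
    proof -
      have "(\<Sum>i<?i. P (i div p) (i mod p) * M $$ (L + i, j)) = (\<Sum>i<?i. - c (L + i) * M $$ (L + i, j))"
        by (intro sum.cong refl) (simp add: P_def)
      then show ?thesis
        unfolding last[where P = P, OF P j] unfolding c[OF j] first[OF j] by (simp add: sum_negf)
    qed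
    show "lead_dep (dim_col M) L U p V k a" unfolding lead_dep_def
      by (intro exI[of _ P] exI[of _ "\<lambda>l. - c l"] conjI P allI impI rel)
  next
    assume "lead_dep (dim_col M) L U p V k a"
    then obtain P d where P: "P k a = 1" "\<forall>b. a < b \<and> b < p \<longrightarrow> P k b = 0"
      and eq: "\<And>j. j < dim_col M \<Longrightarrow> (\<Sum>s\<le>k. \<Sum>b<p. P s b * V s b j) + (\<Sum>l<L. d l * U l j) = 0"
      unfolding lead_dep_def by blast
    define c where "c l = (if l < L then - d l else - P ((l - L) div p) ((l - L) mod p))" for l
    have "M $$ (L + ?i, j) = (\<Sum>l<L + ?i. c l * M $$ (l, j))" if j: "j < dim_col M" for j
      using eq[OF j] unfolding last[where P = P, OF P j] first[OF j] by (simp add: c_def sum_negf)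
    then show "row_dep M (L + ?i)" unfolding row_dep_def by (intro exI[of _ c]) simp
  qed
qed

definition data_dep :: "real mat \<Rightarrow> real mat \<Rightarrow> nat \<Rightarrow> nat \<Rightarrow> bool" where
  "data_dep u y k a \<longleftrightarrow> (\<exists>P Q. P k a = 1 \<and> (\<forall>b. a < b \<and> b < dim_row y \<longrightarrow> P k b = 0) \<and>
     (\<forall>t. t + k < dim_col u \<longrightarrow>
       (\<Sum>s\<le>k. (\<Sum>b<dim_row y. P s b * y $$ (b, t + s)) + (\<Sum>e<dim_row u. Q s e * u $$ (e, t + s))) = 0))"

text \<open>Each Hankel column is a window of the data, and the column index is its starting time.
  The \<open>(k + 1) * dim_row u\<close> input rows serve as base rows; the output rows follow,
  ordered by time.\<close>

lemma data_dep_iff_row_dep: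
  assumes uy: "dim_col y = dim_col u" and k: "k < dim_col u" and a: "a < dim_row y"
  shows "row_dep (H_mat u y k) ((k + 1) * dim_row u + (k * dim_row y + a)) \<longleftrightarrow> data_dep u y k a"
proof -
  let ?H = "H_mat u y k" and ?m = "dim_row u" and ?p = "dim_row y" and ?T = "dim_col u"
  have dc: "dim_col ?H = ?T - k"
    by (simp add: H_mat_def append_rows_def block_hankel_def)
  have U: "?H $$ (l, j) = u $$ (l mod ?m, l div ?m + j)" if "l < (k + 1) * ?m" "j < ?T - k" for l j
    using that uy by (simp add: H_mat_def append_rows_def block_hankel_def)
  have V: "?H $$ ((k + 1) * ?m + (s * ?p + b), j) = y $$ (b, j + s)" if "s \<le> k" "b < ?p" "j < ?T - k" for s b j
    using that uy block_index_less[of s "k + 1" b ?p]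
    by (simp add: H_mat_def append_rows_def block_hankel_def add.commute[of s])
  have "row_dep ?H ((k + 1) * ?m + (k * ?p + a)) \<longleftrightarrow>
      lead_dep (?T - k) ((k + 1) * ?m) (\<lambda>l j. u $$ (l mod ?m, l div ?m + j)) ?p (\<lambda>s b j. y $$ (b, j + s)) k a"
    by (subst row_dep_iff_lead_dep[OF a,
          where U = "\<lambda>l j. u $$ (l mod ?m, l div ?m + j)" and V = "\<lambda>s b j. y $$ (b, j + s)"])
      (use U V in \<open>simp_all add: dc\<close>)
  also have "\<dots> \<longleftrightarrow> data_dep u y k a"
  proof -
    \<comment> \<open>Input rows are numbered by \<open>s * ?m + e\<close>; this passes from flat
      indices to pairs, and \<open>decode\<close> inverts the numbering.\<close>
    have inputs: "(\<Sum>l<(k + 1) * ?m. d l * u $$ (l mod ?m, l div ?m + t)) =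
        (\<Sum>s\<le>k. \<Sum>e<?m. d (s * ?m + e) * u $$ (e, t + s))" for d t
      unfolding sum_blocks Suc_eq_plus1[symmetric] lessThan_Suc_atMost
      by (intro sum.cong refl) (auto simp: add.commute)
    have decode: "(\<Sum>s\<le>k. \<Sum>e<?m. Q ((s * ?m + e) div ?m) ((s * ?m + e) mod ?m) * u $$ (e, t + s)) =
        (\<Sum>s\<le>k. \<Sum>e<?m. Q s e * u $$ (e, t + s))" for Q t
      by (intro sum.cong refl) auto
    show ?thesis
    proof
      assume "lead_dep (?T - k) ((k + 1) * ?m) (\<lambda>l j. u $$ (l mod ?m, l div ?m + j)) ?p (\<lambda>s b j. y $$ (b, j + s)) k a"
      then obtain P d where P: "P k a = 1" "\<forall>b. a < b \<and> b < ?p \<longrightarrow> P k b = 0"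
        and eq: "\<And>j. j < ?T - k \<Longrightarrow> (\<Sum>s\<le>k. \<Sum>b<?p. P s b * y $$ (b, j + s)) +
          (\<Sum>l<(k + 1) * ?m. d l * u $$ (l mod ?m, l div ?m + j)) = 0"
        unfolding lead_dep_def by blast
      have rel: "(\<Sum>s\<le>k. (\<Sum>b<?p. P s b * y $$ (b, t + s)) + (\<Sum>e<?m. d (s * ?m + e) * u $$ (e, t + s))) = 0"
        if "t + k < ?T" for t
        using eq[unfolded inputs, of t] that unfolding sum.distrib by linarith
      show "data_dep u y k a" unfolding data_dep_def
        by (intro exI[of _ P] exI[of _ "\<lambda>s e. d (s * ?m + e)"] conjI P allI impI rel)
    next
      assume "data_dep u y k a"
      then obtain P Q where P: "P k a = 1" "\<forall>b. a < b \<and> b < ?p \<longrightarrow> P k b = 0"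
        and eq: "\<And>t. t + k < ?T \<Longrightarrow> (\<Sum>s\<le>k. (\<Sum>b<?p. P s b * y $$ (b, t + s)) + (\<Sum>e<?m. Q s e * u $$ (e, t + s))) = 0"
        unfolding data_dep_def by blast
      have rel: "(\<Sum>s\<le>k. \<Sum>b<?p. P s b * y $$ (b, j + s)) +
          (\<Sum>l<(k + 1) * ?m. Q (l div ?m) (l mod ?m) * u $$ (l mod ?m, l div ?m + j)) = 0" if "j < ?T - k" for j
        using eq[of j] that unfolding inputs decode sum.distrib by linarith
      show "lead_dep (?T - k) ((k + 1) * ?m) (\<lambda>l j. u $$ (l mod ?m, l div ?m + j)) ?p (\<lambda>s b j. y $$ (b, j + s)) k a"
        unfolding lead_dep_def
        by (intro exI[of _ P] exI[of _ "\<lambda>l. Q (l div ?m) (l mod ?m)"] conjI P allI impI rel)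
    qed
  qed
  finally show ?thesis .
qed

section \<open>\<delta> as a count of independent outputs, and its behaviour in the order\<close>

lemma card_rows_append:
  "card {i. i < r + n \<and> P i} = card {i. i < r \<and> P i} + card {a. a < n \<and> P (r + a)}" for r n :: nat
proof -
  have "{i. i < r + n \<and> P i} = {i. i < r \<and> P i} \<union> (+) r ` {a. a < n \<and> P (r + a)}"
  proof (intro equalityI subsetI)
    fix i assume i: "i \<in> {i. i < r + n \<and> P i}"
    show "i \<in> {i. i < r \<and> P i} \<union> (+) r ` {a. a < n \<and> P (r + a)}"
    proof (cases "i < r")
      case False
      then show ?thesis using i by (intro UnI2 image_eqI[of _ _ "i - r"]) auto
    qed (use i in simp)
  qed auto
  moreover have "{i. i < r \<and> P i} \<inter> (+) r ` {a. a < n \<and> P (r + a)} = {}" by auto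
  ultimately show ?thesis by (simp add: card_Un_disjoint card_image)
qed

text \<open>\<open>G_mat\<close> consists of the first \<open>r\<close> rows of
  \<open>H_mat\<close>, and dependence of a row concerns only the rows above it. So both matrices
  keep the same rows among these, and the rank difference counts the kept rows among the last
  \<open>dim_row y\<close>.\<close>

lemma delta_eq_card:
  assumes uy: "dim_col y = dim_col u" and k: "k < dim_col u"
  shows "delta u y k = card {a. a < dim_row y \<and> \<not> data_dep u y k a}"
proof -
  let ?H = "H_mat u y k" and ?G = "G_mat u y k"
  define r where "r = (k + 1) * dim_row u + k * dim_row y"
  have dH: "dim_row ?H = r + dim_row y"
    by (simp add: r_def H_mat_def append_rows_def block_hankel_def)
  have dG: "dim_row ?G = r" "dim_col ?G = dim_col ?H"
    using dH by (simp_all add: G_mat_def)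
  have "row_dep ?G i \<longleftrightarrow> row_dep ?H i" if "i < r" for i
    using that dH unfolding row_dep_def dG by (simp add: G_mat_def)
  then have "{i. i < r \<and> \<not> row_dep ?G i} = {i. i < r \<and> \<not> row_dep ?H i}" by blast
  then have "delta u y k = card {a. a < dim_row y \<and> \<not> row_dep ?H (r + a)}"
    unfolding delta_def mat_rank_card_rows dH dG card_rows_append by simp
  also have "{a. a < dim_row y \<and> \<not> row_dep ?H (r + a)} = {a. a < dim_row y \<and> \<not> data_dep u y k a}"
    using data_dep_iff_row_dep[OF uy k] by (auto simp: r_def add.assoc)
  finally show ?thesis .
qed

text \<open>The relation on the window starting at \<open>t + 1\<close> is one on the longer window
  starting at \<open>t\<close>, with zero coefficients at its first sample.\<close>

lemma data_dep_Suc: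
  assumes "data_dep u y k a"
  shows "data_dep u y (Suc k) a"
proof -
  from assms obtain P Q where P: "P k a = 1" "\<forall>b. a < b \<and> b < dim_row y \<longrightarrow> P k b = 0"
    and eq: "\<And>t. t + k < dim_col u \<Longrightarrow>
      (\<Sum>s\<le>k. (\<Sum>b<dim_row y. P s b * y $$ (b, t + s)) + (\<Sum>e<dim_row u. Q s e * u $$ (e, t + s))) = 0"
    unfolding data_dep_def by blast
  define P' where "P' s b = (if s = 0 then 0 else P (s - 1) b)" for s b
  define Q' where "Q' s e = (if s = 0 then 0 else Q (s - 1) e)" for s e
  have "(\<Sum>s\<le>Suc k. (\<Sum>b<dim_row y. P' s b * y $$ (b, t + s)) + (\<Sum>e<dim_row u. Q' s e * u $$ (e, t + s))) = 0"
    if "t + Suc k < dim_col u" for t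
    using eq[of "Suc t"] that unfolding sum.atMost_Suc_shift by (simp add: P'_def Q'_def)
  moreover have "P' (Suc k) a = 1" "\<forall>b. a < b \<and> b < dim_row y \<longrightarrow> P' (Suc k) b = 0"
    using P by (auto simp: P'_def)
  ultimately show ?thesis unfolding data_dep_def by (intro exI[of _ P'] exI[of _ Q']) simp
qed

lemma data_dep_mono:
  assumes "k \<le> k'" "data_dep u y k a"
  shows "data_dep u y k' a"
  using assms by (induction k' rule: dec_induct) (auto intro: data_dep_Suc)

text \<open>At order \<open>dim_col u - 1\<close> only the window \<open>t = 0\<close> exists, so
  one nonzero input entry can cancel any output sample. This is how a nonzero input makes
  \<open>q\<close> well defined.\<close>

lemma data_dep_last:
  assumes "0 < dim_col u" "e < dim_row u" "s < dim_col u" "u $$ (e, s) \<noteq> 0" "a < dim_row y"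
  shows "data_dep u y (dim_col u - 1) a"
proof -
  let ?k = "dim_col u - 1"
  define P where "P s' b = (if s' = ?k \<and> b = a then 1 else 0 :: real)" for s' b
  \<comment> \<open>Scaled so that the entry \<open>u $$ (e, s)\<close> cancels the last sample of
    output \<open>a\<close>.\<close>
  define Q where "Q s' e' = (if s' = s \<and> e' = e then - y $$ (a, ?k) / u $$ (e, s) else 0)" for s' e'
  have Ps: "(\<Sum>b<dim_row y. P s' b * y $$ (b, s')) = (if s' = ?k then y $$ (a, ?k) else 0)" for s'
  proof -
    have "(\<Sum>b<dim_row y. P s' b * y $$ (b, s')) = (\<Sum>b<dim_row y. if b = a then P s' b * y $$ (b, s') else 0)"
      by (intro sum.cong) (auto simp: P_def)
    then show ?thesis using assms(5) by (simp add: P_def)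
  qed
  have Qs: "(\<Sum>e'<dim_row u. Q s' e' * u $$ (e', s')) = (if s' = s then - y $$ (a, ?k) else 0)" for s'
  proof -
    have "(\<Sum>e'<dim_row u. Q s' e' * u $$ (e', s')) = (\<Sum>e'<dim_row u. if e' = e then Q s' e' * u $$ (e', s') else 0)"
      by (intro sum.cong) (auto simp: Q_def)
    then show ?thesis using assms(2,4) by (simp add: Q_def)
  qed
  have "(\<Sum>s'\<le>?k. (\<Sum>b<dim_row y. P s' b * y $$ (b, t + s')) +
      (\<Sum>e'<dim_row u. Q s' e' * u $$ (e', t + s'))) = 0" if "t + ?k < dim_col u" for t
  proof -
    have "t = 0" using that by simp
    then show ?thesis using assms(3) by (simp add: sum.distrib Ps Qs)
  qed
  moreover have "P ?k a = 1" "\<forall>b. a < b \<and> b < dim_row y \<longrightarrow> P ?k b = 0" by (auto simp: P_def)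
  ultimately show ?thesis unfolding data_dep_def by (intro exI[of _ P] exI[of _ Q]) simp
qed

subsection \<open>The lag of an explaining system\<close>

lemma index_mult_mat_vec_sum:
  assumes "A \<in> carrier_mat r n" "v \<in> carrier_vec n" "i < r"
  shows "(A *\<^sub>v v) $ i = (\<Sum>j<n. A $$ (i, j) * v $ j)"
  using assms by (auto simp: scalar_prod_def atLeast0LessThan intro!: sum.cong)

lemma trajectory_entries:
  assumes A: "A \<in> carrier_mat n n" and B: "B \<in> carrier_mat n m"
    and C: "C \<in> carrier_mat p n" and D: "D \<in> carrier_mat p m"
    and x: "x \<in> carrier_mat n (T + 1)" and u: "u \<in> carrier_mat m T" and y: "y \<in> carrier_mat p T" and t: "t < T"
  shows "col x (t + 1) = A *\<^sub>v col x t + B *\<^sub>v col u t \<longleftrightarrow>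
      (\<forall>i<n. x $$ (i, t + 1) = (\<Sum>j<n. A $$ (i, j) * x $$ (j, t)) + (\<Sum>e<m. B $$ (i, e) * u $$ (e, t)))"
    and "col y t = C *\<^sub>v col x t + D *\<^sub>v col u t \<longleftrightarrow>
      (\<forall>i<p. y $$ (i, t) = (\<Sum>j<n. C $$ (i, j) * x $$ (j, t)) + (\<Sum>e<m. D $$ (i, e) * u $$ (e, t)))"
proof -
  have xt: "col x t \<in> carrier_vec n" and ut: "col u t \<in> carrier_vec m" using x u by auto
  have "(M *\<^sub>v col x t) $ i = (\<Sum>j<n. M $$ (i, j) * x $$ (j, t))" if "M \<in> carrier_mat r n" "i < r" for M r i
    unfolding index_mult_mat_vec_sum[OF that(1) xt that(2)] using x t by (intro sum.cong) auto
  moreover have "(M *\<^sub>v col u t) $ i = (\<Sum>e<m. M $$ (i, e) * u $$ (e, t))" if "M \<in> carrier_mat r m" "i < r" for M r i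
    unfolding index_mult_mat_vec_sum[OF that(1) ut that(2)] using u t by (intro sum.cong) auto
  ultimately show "col x (t + 1) = A *\<^sub>v col x t + B *\<^sub>v col u t \<longleftrightarrow>
      (\<forall>i<n. x $$ (i, t + 1) = (\<Sum>j<n. A $$ (i, j) * x $$ (j, t)) + (\<Sum>e<m. B $$ (i, e) * u $$ (e, t)))"
    and "col y t = C *\<^sub>v col x t + D *\<^sub>v col u t \<longleftrightarrow>
      (\<forall>i<p. y $$ (i, t) = (\<Sum>j<n. C $$ (i, j) * x $$ (j, t)) + (\<Sum>e<m. D $$ (i, e) * u $$ (e, t)))"
    using A B C D x y t by (simp_all add: vec_eq_iff)
qed

text \<open>Iterating the state equation \<open>s\<close> times from time \<open>t\<close> leaves
  row \<open>b\<close> of \<open>C * A^s\<close> applied to the state, plus inputs from the window.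
  The coefficients \<open>F\<close> do not depend on \<open>t\<close>, so one relation can serve all
  windows.\<close>

lemma output_expansion:
  fixes x u y :: "real mat"
  assumes A: "A \<in> carrier_mat n n" and C: "C \<in> carrier_mat p n" and b: "b < p"
    and x: "\<And>t i. t < T \<Longrightarrow> i < n \<Longrightarrow>
      x $$ (i, t + 1) = (\<Sum>j<n. A $$ (i, j) * x $$ (j, t)) + (\<Sum>e<m. B $$ (i, e) * u $$ (e, t))"
    and y: "\<And>t. t < T \<Longrightarrow>
      y $$ (b, t) = (\<Sum>j<n. C $$ (b, j) * x $$ (j, t)) + (\<Sum>e<m. D $$ (b, e) * u $$ (e, t))"
  shows "\<exists>F. \<forall>t. t + s < T \<longrightarrow> y $$ (b, t + s) =
    (\<Sum>j<n. (C * A ^\<^sub>m s) $$ (b, j) * x $$ (j, t)) + (\<Sum>r\<le>s. \<Sum>e<m. F r e * u $$ (e, t + r))"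
proof (induction s)
  case 0
  show ?case using y A C by (intro exI[of _ "\<lambda>r e. D $$ (b, e)"]) simp
next
  case (Suc s)
  let ?O = "\<lambda>s j. (C * A ^\<^sub>m s) $$ (b, j)"
  obtain F where F: "\<And>t. t + s < T \<Longrightarrow> y $$ (b, t + s) =
    (\<Sum>j<n. ?O s j * x $$ (j, t)) + (\<Sum>r\<le>s. \<Sum>e<m. F r e * u $$ (e, t + r))"
    using Suc.IH by blast
  have As: "C * A ^\<^sub>m s \<in> carrier_mat p n" using A C by simp
  \<comment> \<open>\<open>A\<close> is split off on the right, where it acts on the state
    first.\<close>
  have power: "C * A ^\<^sub>m Suc s = C * A ^\<^sub>m s * A"
    using assoc_mult_mat[OF C pow_carrier_mat[OF A] A] by simp
  have O_Suc: "?O (Suc s) i = (\<Sum>j<n. ?O s j * A $$ (j, i))" if "i < n" for i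
  proof -
    have "(C * A ^\<^sub>m s * A) $$ (b, i) = row (C * A ^\<^sub>m s) b \<bullet> col A i"
      using that A As b by (intro index_mult_mat(1)) (simp_all only: carrier_matD)
    also have "\<dots> = (\<Sum>j<n. ?O s j * A $$ (j, i))"
      using that A As b unfolding scalar_prod_def
      by (simp only: carrier_matD dim_col atLeast0LessThan)
        (intro sum.cong refl, simp only: lessThan_iff index_row index_col carrier_matD)
    finally show ?thesis unfolding power .
  qed
  \<comment> \<open>Expanding from \<open>t + 1\<close> moves every input coefficient one step
    later; the freed first place holds row \<open>b\<close> of \<open>C * A^s * B\<close>.\<close>
  define G where "G r e = (if r = 0 then \<Sum>j<n. ?O s j * B $$ (j, e) else F (r - 1) e)" for r e
  have "y $$ (b, t + Suc s) = (\<Sum>j<n. ?O (Suc s) j * x $$ (j, t)) + (\<Sum>r\<le>Suc s. \<Sum>e<m. G r e * u $$ (e, t + r))"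
    if t: "t + Suc s < T" for t
  proof -
    have "(\<Sum>j<n. ?O s j * x $$ (j, Suc t)) =
        (\<Sum>j<n. \<Sum>i<n. ?O s j * A $$ (j, i) * x $$ (i, t)) + (\<Sum>j<n. \<Sum>e<m. ?O s j * B $$ (j, e) * u $$ (e, t))"
      unfolding sum.distrib[symmetric] using x[of t] t
      by (intro sum.cong refl) (simp add: sum_distrib_left distrib_left mult.assoc)
    also have "(\<Sum>j<n. \<Sum>i<n. ?O s j * A $$ (j, i) * x $$ (i, t)) = (\<Sum>i<n. ?O (Suc s) i * x $$ (i, t))"
      by (subst sum.swap) (intro sum.cong refl, simp only: lessThan_iff O_Suc sum_distrib_right)
    also have "(\<Sum>j<n. \<Sum>e<m. ?O s j * B $$ (j, e) * u $$ (e, t)) = (\<Sum>e<m. G 0 e * u $$ (e, t))"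
      by (subst sum.swap) (simp add: G_def sum_distrib_right)
    finally show ?thesis
      using F[of "Suc t"] t unfolding sum.atMost_Suc_shift by (simp add: G_def)
  qed
  then show ?case by (intro exI[of _ G]) simp
qed

section \<open>Rank increments of the observability matrices\<close>

lemma obs_mat_dims [simp]: "dim_row (obs_mat C A k) = k * dim_row C" "dim_col (obs_mat C A k) = dim_col C"
  by (simp_all add: obs_mat_def)

lemma obs_mat_row_dep_iff_lead_dep:
  assumes "a < dim_row C"
  shows "row_dep (obs_mat C A (k + 1)) (k * dim_row C + a) \<longleftrightarrow>
    lead_dep (dim_col C) 0 (\<lambda>_ _. 0) (dim_row C) (\<lambda>s b j. (C * A ^\<^sub>m s) $$ (b, j)) k a"
proof -
  have "obs_mat C A (k + 1) $$ (0 + (s * dim_row C + b), j) = (C * A ^\<^sub>m s) $$ (b, j)"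
    if "s \<le> k" "b < dim_row C" "j < dim_col C" for s b j
    using that block_index_less[of s "k + 1" b "dim_row C"] by (simp add: obs_mat_def)
  then show ?thesis
    using row_dep_iff_lead_dep[OF assms, of 0 "obs_mat C A (k + 1)" "\<lambda>_ _. 0" k "\<lambda>s b j. (C * A ^\<^sub>m s) $$ (b, j)"]
    by simp
qed

text \<open>A new block leaves the rows above it unchanged, so exactly its kept rows add to the
  rank.\<close>

lemma obs_mat_rank_Suc:
  "mat_rank (obs_mat C A (k + 1)) = mat_rank (obs_mat C A k) +
    card {a. a < dim_row C \<and> \<not> row_dep (obs_mat C A (k + 1)) (k * dim_row C + a)}"
proof -
  have "row_dep (obs_mat C A (k + 1)) i \<longleftrightarrow> row_dep (obs_mat C A k) i" if "i < k * dim_row C" for i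
    using that unfolding row_dep_def obs_mat_dims by (simp add: obs_mat_def)
  then have "{i. i < k * dim_row C \<and> \<not> row_dep (obs_mat C A (k + 1)) i} =
      {i. i < k * dim_row C \<and> \<not> row_dep (obs_mat C A k) i}" by blast
  moreover have "(k + 1) * dim_row C = k * dim_row C + dim_row C" by simp
  ultimately show ?thesis
    unfolding mat_rank_card_rows obs_mat_dims by (simp only: card_rows_append)
qed

text \<open>Applying the coefficients of a row relation to the outputs of a window cancels the
  state, by \<open>output_expansion\<close>, and leaves only inputs of that window.\<close>

lemma data_dep_if_obs_mat_row_dep:
  assumes A: "A \<in> carrier_mat n n" and C: "C \<in> carrier_mat (dim_row y) n"
    and x: "\<And>t i. t < dim_col u \<Longrightarrow> i < n \<Longrightarrow>
      x $$ (i, t + 1) = (\<Sum>j<n. A $$ (i, j) * x $$ (j, t)) + (\<Sum>e<dim_row u. B $$ (i, e) * u $$ (e, t))"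
    and y: "\<And>t i. t < dim_col u \<Longrightarrow> i < dim_row y \<Longrightarrow>
      y $$ (i, t) = (\<Sum>j<n. C $$ (i, j) * x $$ (j, t)) + (\<Sum>e<dim_row u. D $$ (i, e) * u $$ (e, t))"
    and a: "a < dim_row y" and dep: "row_dep (obs_mat C A (k + 1)) (k * dim_row C + a)"
  shows "data_dep u y k a"
proof -
  let ?m = "dim_row u" and ?p = "dim_row y" and ?T = "dim_col u"
  let ?O = "\<lambda>s b j. (C * A ^\<^sub>m s) $$ (b, j)"
  have "lead_dep n 0 (\<lambda>_ _. 0) ?p ?O k a"
    using dep obs_mat_row_dep_iff_lead_dep[of a C A k] a C by simp
  then obtain P where P: "P k a = 1" "\<forall>b. a < b \<and> b < ?p \<longrightarrow> P k b = 0"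
    and zero: "\<And>j. j < n \<Longrightarrow> (\<Sum>s\<le>k. \<Sum>b<?p. P s b * ?O s b j) = 0"
    unfolding lead_dep_def by auto
  have "\<exists>F. \<forall>t. t + s < ?T \<longrightarrow> y $$ (b, t + s) =
    (\<Sum>j<n. ?O s b j * x $$ (j, t)) + (\<Sum>r\<le>s. \<Sum>e<?m. F r e * u $$ (e, t + r))" if "b < ?p" for s b
    by (rule output_expansion[OF A C that x y[OF _ that]])
  then have "\<forall>s b. \<exists>F. b < ?p \<longrightarrow> (\<forall>t. t + s < ?T \<longrightarrow> y $$ (b, t + s) =
    (\<Sum>j<n. ?O s b j * x $$ (j, t)) + (\<Sum>r\<le>s. \<Sum>e<?m. F r e * u $$ (e, t + r)))" by blast
  then obtain F where F: "\<And>s b t. b < ?p \<Longrightarrow> t + s < ?T \<Longrightarrow> y $$ (b, t + s) =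
    (\<Sum>j<n. ?O s b j * x $$ (j, t)) + (\<Sum>r\<le>s. \<Sum>e<?m. F s b r e * u $$ (e, t + r))"
    unfolding choice_iff by blast
  \<comment> \<open>Padding by zero gives all input sums the common range \<open>r \<le> k\<close>,
    so that the sums can be interchanged.\<close>
  define G where "G s b r e = (if r \<le> s then P s b * F s b r e else 0)" for s b r e
  have "(\<Sum>s\<le>k. (\<Sum>b<?p. P s b * y $$ (b, t + s)) +
      (\<Sum>e<?m. - (\<Sum>s'\<le>k. \<Sum>b<?p. G s' b s e) * u $$ (e, t + s))) = 0" if t: "t + k < ?T" for t
  proof -
    have "(\<Sum>s\<le>k. \<Sum>b<?p. P s b * y $$ (b, t + s)) =
        (\<Sum>s\<le>k. \<Sum>b<?p. (\<Sum>j<n. P s b * ?O s b j * x $$ (j, t)) + (\<Sum>r\<le>k. \<Sum>e<?m. G s b r e * u $$ (e, t + r)))"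
    proof (intro sum.cong refl)
      fix s b assume s: "s \<in> {..k}" and b: "b \<in> {..<?p}"
      have "(\<Sum>r\<le>s. \<Sum>e<?m. P s b * (F s b r e * u $$ (e, t + r))) = (\<Sum>r\<le>k. \<Sum>e<?m. G s b r e * u $$ (e, t + r))"
        using s by (intro sum.mono_neutral_cong_left) (auto simp: G_def mult.assoc)
      then show "P s b * y $$ (b, t + s) =
          (\<Sum>j<n. P s b * ?O s b j * x $$ (j, t)) + (\<Sum>r\<le>k. \<Sum>e<?m. G s b r e * u $$ (e, t + r))"
        using F[of b t s] s b t by (simp add: distrib_left sum_distrib_left mult.assoc)
    qed
    also have "\<dots> = (\<Sum>s\<le>k. \<Sum>b<?p. \<Sum>j<n. P s b * ?O s b j * x $$ (j, t)) +
        (\<Sum>s\<le>k. \<Sum>b<?p. \<Sum>r\<le>k. \<Sum>e<?m. G s b r e * u $$ (e, t + r))"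
      by (simp only: sum.distrib)
    \<comment> \<open>Rearranged so that each state entry has as its factor a combination that
      vanishes by \<open>zero\<close>.\<close>
    also have "(\<Sum>s\<le>k. \<Sum>b<?p. \<Sum>j<n. P s b * ?O s b j * x $$ (j, t)) =
        (\<Sum>j<n. (\<Sum>s\<le>k. \<Sum>b<?p. P s b * ?O s b j) * x $$ (j, t))"
      by (simp only: sum.swap[of _ "{..<n}"] sum_distrib_right)
    also have "\<dots> = 0" using zero by (intro sum.neutral) simp
    also have "(\<Sum>s\<le>k. \<Sum>b<?p. \<Sum>r\<le>k. \<Sum>e<?m. G s b r e * u $$ (e, t + r)) =
        (\<Sum>r\<le>k. \<Sum>s\<le>k. \<Sum>b<?p. \<Sum>e<?m. G s b r e * u $$ (e, t + r))"
      by (subst sum.swap[of _ "{..k}" "{..<?p}"]) (rule sum.swap)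
    also have "\<dots> = (\<Sum>r\<le>k. \<Sum>e<?m. (\<Sum>s\<le>k. \<Sum>b<?p. G s b r e) * u $$ (e, t + r))"
      by (simp only: sum.swap[of _ "{..<?m}"] sum_distrib_right)
    finally have "(\<Sum>s\<le>k. \<Sum>b<?p. P s b * y $$ (b, t + s)) =
      (\<Sum>r\<le>k. \<Sum>e<?m. (\<Sum>s\<le>k. \<Sum>b<?p. G s b r e) * u $$ (e, t + r))" by simp
    then show ?thesis by (simp only: sum.distrib mult_minus_left sum_negf add.right_inverse)
  qed
  then show ?thesis unfolding data_dep_def
    by (intro exI[of _ P] exI[of _ "\<lambda>r e. - (\<Sum>s\<le>k. \<Sum>b<?p. G s b r e)"] conjI P allI impI)
qed

lemma mat_rank_le_dim_col: "mat_rank M \<le> dim_col M"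
  unfolding mat_rank_def by (intro vec_space.rank_le_nc[of _ _ "dim_col M"]) simp

text \<open>A squeeze: the rank increments dominate \<open>delta\<close>, while their sum up to
  \<open>q\<close> is the rank of a matrix with \<open>n\<close> columns, and \<open>n\<close> is
  the sum of \<open>delta\<close>. Hence they agree up to \<open>q\<close> and have the same first
  zero.\<close>

lemma lag_of_explaining_system:
  assumes A: "A \<in> carrier_mat n n" and B: "B \<in> carrier_mat n (dim_row u)"
    and C: "C \<in> carrier_mat (dim_row y) n" and D: "D \<in> carrier_mat (dim_row y) (dim_row u)"
    and xdim: "x \<in> carrier_mat n (dim_col u + 1)" and uy: "dim_col y = dim_col u"
    and traj: "\<forall>t<dim_col u. col x (t + 1) = A *\<^sub>v col x t + B *\<^sub>v col u t \<and>
      col y t = C *\<^sub>v col x t + D *\<^sub>v col u t"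
    and q: "q < dim_col u" "delta u y q = 0" "\<And>k. k < q \<Longrightarrow> delta u y k \<noteq> 0"
    and n: "n = (\<Sum>k\<le>q. delta u y k)"
  shows "lag C A = q"
proof -
  let ?r = "\<lambda>k. mat_rank (obs_mat C A k)"
  \<comment> \<open>The rank increment from \<Omega> with index \<open>k - 1\<close> to \<Omega>
    with index \<open>k\<close>.\<close>
  define rho where "rho k = card {a. a < dim_row C \<and> \<not> row_dep (obs_mat C A (k + 1)) (k * dim_row C + a)}" for k
  have step: "?r (Suc k) = ?r k + rho k" for k
    using obs_mat_rank_Suc[of C A k] unfolding rho_def by simp
  have "?r 0 = 0" by (simp add: mat_rank_card_rows)
  then have "?r k = (\<Sum>i<k. rho i)" for k
    by (induction k) (simp_all only: step sum.lessThan_Suc lessThan_0 sum.empty)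
  then have "(\<Sum>k\<le>q. rho k) \<le> n"
    using mat_rank_le_dim_col[of "obs_mat C A (Suc q)"] C by (simp flip: lessThan_Suc_atMost)
  have ucar: "u \<in> carrier_mat (dim_row u) (dim_col u)" and ycar: "y \<in> carrier_mat (dim_row y) (dim_col u)"
    using uy by auto
  note entries = trajectory_entries[OF A B C D xdim ucar ycar]
  have "delta u y k \<le> rho k" if k: "k < dim_col u" for k
  proof -
    have "data_dep u y k a" if "a < dim_row y" "row_dep (obs_mat C A (k + 1)) (k * dim_row C + a)" for a
      using traj entries by (intro data_dep_if_obs_mat_row_dep[OF A C _ _ that, of u x B D]) auto
    then show ?thesis
      unfolding delta_eq_card[OF uy k] rho_def using C by (intro card_mono) auto
  qed
  then have le: "delta u y k \<le> rho k" if "k \<le> q" for k using that q(1) by simp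
  have eq: "rho k = delta u y k" if "k \<le> q" for k
  proof (rule ccontr)
    assume "rho k \<noteq> delta u y k"
    then have "delta u y k < rho k" using le[OF that] by simp
    then have "(\<Sum>k\<le>q. delta u y k) < (\<Sum>k\<le>q. rho k)"
      using le that by (intro sum_strict_mono_ex1) (auto intro!: bexI[of _ k])
    then show False using n \<open>(\<Sum>k\<le>q. rho k) \<le> n\<close> by simp
  qed
  show ?thesis unfolding lag_def
  proof (rule Least_equality)
    show "?r (q + 1) = ?r q" using step[of q] eq[of q] q(2) by simp
  next
    fix k assume "?r (k + 1) = ?r k"
    then have "rho k = 0" using step[of k] by simp
    \<comment> \<open>A zero increment below \<open>q\<close> would force
      \<open>delta u y k = 0\<close> there.\<close>
    then show "q \<le> k" using eq[of k] q(3)[of k] by (metis linorder_not_le order_less_imp_le)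
  qed
qed

subsection \<open>Realization in observer form\<close>

text \<open>Signals given on \<open>[0, T - 1]\<close> by one fixed linear function of current state
  and input. The coefficients \<open>c\<close> and \<open>d\<close> become a row of \<open>A\<close>
  and \<open>B\<close>, or of \<open>C\<close> and \<open>D\<close>; closure under linear
  combinations replaces writing out the observer form.\<close>

definition io_linear :: "nat \<Rightarrow> nat \<Rightarrow> nat \<Rightarrow> (nat \<Rightarrow> nat \<Rightarrow> real) \<Rightarrow> (nat \<Rightarrow> nat \<Rightarrow> real) \<Rightarrow> (nat \<Rightarrow> real) \<Rightarrow> bool" where
  "io_linear T n m x u f \<longleftrightarrow>
    (\<exists>c d. \<forall>t<T. f t = (\<Sum>i<n. c i * x i t) + (\<Sum>e<m. d e * u e t))"

lemma io_linear_cong: "io_linear T n m x u f \<Longrightarrow> (\<And>t. t < T \<Longrightarrow> g t = f t) \<Longrightarrow> io_linear T n m x u g"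
  unfolding io_linear_def by simp

lemma io_linear_add:
  assumes "io_linear T n m x u f" "io_linear T n m x u g"
  shows "io_linear T n m x u (\<lambda>t. f t + g t)"
proof -
  obtain c d where f: "\<And>t. t < T \<Longrightarrow> f t = (\<Sum>i<n. c i * x i t) + (\<Sum>e<m. d e * u e t)"
    using assms(1) unfolding io_linear_def by blast
  obtain c' d' where g: "\<And>t. t < T \<Longrightarrow> g t = (\<Sum>i<n. c' i * x i t) + (\<Sum>e<m. d' e * u e t)"
    using assms(2) unfolding io_linear_def by blast
  have "f t + g t = (\<Sum>i<n. (c i + c' i) * x i t) + (\<Sum>e<m. (d e + d' e) * u e t)" if "t < T" for t
    using f[OF that] g[OF that] by (simp add: distrib_right sum.distrib)
  then show ?thesis unfolding io_linear_def
    by (intro exI[of _ "\<lambda>i. c i + c' i"] exI[of _ "\<lambda>e. d e + d' e"] allI impI)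
qed

lemma io_linear_scale:
  assumes "io_linear T n m x u f"
  shows "io_linear T n m x u (\<lambda>t. a * f t)"
proof -
  obtain c d where f: "\<And>t. t < T \<Longrightarrow> f t = (\<Sum>i<n. c i * x i t) + (\<Sum>e<m. d e * u e t)"
    using assms unfolding io_linear_def by blast
  have "a * f t = (\<Sum>i<n. (a * c i) * x i t) + (\<Sum>e<m. (a * d e) * u e t)" if "t < T" for t
    using f[OF that] by (simp add: distrib_left sum_distrib_left mult.assoc)
  then show ?thesis unfolding io_linear_def
    by (intro exI[of _ "\<lambda>i. a * c i"] exI[of _ "\<lambda>e. a * d e"] allI impI)
qed

lemma io_linear_diff:
  assumes "io_linear T n m x u f" "io_linear T n m x u g"
  shows "io_linear T n m x u (\<lambda>t. f t - g t)"
  using io_linear_add[OF assms(1) io_linear_scale[OF assms(2), of "- 1"]] by simp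

lemma io_linear_zero: "io_linear T n m x u (\<lambda>_. 0)"
  unfolding io_linear_def by (intro exI[of _ "\<lambda>_. 0"]) simp

lemma io_linear_sum:
  "(\<And>s. s \<in> S \<Longrightarrow> io_linear T n m x u (f s)) \<Longrightarrow> io_linear T n m x u (\<lambda>t. \<Sum>s\<in>S. f s t)"
  by (induction S rule: infinite_finite_induct) (simp_all add: io_linear_zero io_linear_add)

lemma io_linear_state: "i < n \<Longrightarrow> io_linear T n m x u (x i)"
proof -
  assume "i < n"
  then have "(\<Sum>j<n. (if j = i then 1 else 0) * x j t) = x i t" for t
    by (subst sum.remove[of _ i]) auto
  then show ?thesis unfolding io_linear_def
    by (intro exI[of _ "\<lambda>j. if j = i then 1 else 0"] exI[of _ "\<lambda>_. 0"]) simp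
qed

lemma io_linear_input: "i < m \<Longrightarrow> io_linear T n m x u (u i)"
proof -
  assume "i < m"
  then have "(\<Sum>j<m. (if j = i then 1 else 0) * u j t) = u i t" for t
    by (subst sum.remove[of _ i]) auto
  then show ?thesis unfolding io_linear_def
    by (intro exI[of _ "\<lambda>_. 0"] exI[of _ "\<lambda>j. if j = i then 1 else 0"]) simp
qed

text \<open>Shift-and-cut states of the relation \<open>\<Sum>s\<le>k. w s (t + s) = 0\<close>: state \<open>r\<close> at time \<open>t\<close> is the tail
  \<open>\<Sum>s=r..k. w s (t + s - r)\<close>. The recursion in \<open>t\<close> keeps it defined near the end of the data, where the
  tail would need samples beyond the horizon.\<close>

primrec cut_state :: "(nat \<Rightarrow> nat \<Rightarrow> real) \<Rightarrow> nat \<Rightarrow> nat \<Rightarrow> nat \<Rightarrow> real" where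
  "cut_state w k 0 r = (if r = 0 then 0 else \<Sum>s=r..k. w s (s - r))"
| "cut_state w k (Suc t) r = (if r = 0 then 0 else cut_state w k t (r - 1) - w (r - 1) t)"

lemma cut_state_0 [simp]: "cut_state w k t 0 = 0"
  by (cases t) auto

text \<open>Each step of the recursion removes the first summand of a tail; for \<open>r = 0\<close>
  the tail is the whole relation and thus 0. The bound \<open>t + k < T + r\<close> keeps the last
  sample, at time \<open>t + k - r\<close>, inside the horizon; for \<open>r = k\<close> it reads
  \<open>t < T\<close>.\<close>

lemma cut_state_eq:
  assumes rel: "\<And>t. t + k < T \<Longrightarrow> (\<Sum>s\<le>k. w s (t + s)) = 0"
    and "r \<le> k" "t + k < T + r"
  shows "cut_state w k t r = (\<Sum>s=r..k. w s (t + s - r))"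
  using assms(2,3)
proof (induction t arbitrary: r)
  case 0
  show ?case using rel[of 0] 0 by (cases "r = 0") (auto simp: atMost_atLeast0)
next
  case (Suc t)
  show ?case
  proof (cases r)
    case 0
    then show ?thesis using rel[of "Suc t"] Suc.prems by (simp add: atMost_atLeast0)
  next
    case (Suc r')
    have "cut_state w k t r' = (\<Sum>s=r'..k. w s (t + s - r'))"
      using Suc.IH[of r'] Suc.prems \<open>r = Suc r'\<close> by simp
    also have "\<dots> = w r' t + (\<Sum>s=r..k. w s (t + s - r'))"
      using Suc.prems \<open>r = Suc r'\<close> by (simp add: sum.atLeast_Suc_atMost)
    finally show ?thesis using \<open>r = Suc r'\<close> by simp
  qed
qed

text \<open>Output \<open>a\<close> contributes the \<open>\<kappa> a\<close> cut states of its
  relation. The top cut states give triangular equations for the outputs, and the recursion of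
  \<open>cut_state\<close> expresses next states by current states, outputs and inputs.\<close>

lemma explaining_system_exists:
  fixes u y :: "real mat" and \<kappa> :: "nat \<Rightarrow> nat"
  assumes uy: "dim_col y = dim_col u"
    and dep: "\<And>a. a < dim_row y \<Longrightarrow> data_dep u y (\<kappa> a) a"
  defines "n \<equiv> \<Sum>a<dim_row y. \<kappa> a"
  shows "\<exists>A B C D x. A \<in> carrier_mat n n \<and> B \<in> carrier_mat n (dim_row u) \<and>
    C \<in> carrier_mat (dim_row y) n \<and> D \<in> carrier_mat (dim_row y) (dim_row u) \<and>
    x \<in> carrier_mat n (dim_col u + 1) \<and>
    (\<forall>t<dim_col u. col x (t + 1) = A *\<^sub>v col x t + B *\<^sub>v col u t \<and>
      col y t = C *\<^sub>v col x t + D *\<^sub>v col u t)"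
proof -
  let ?m = "dim_row u" and ?p = "dim_row y" and ?T = "dim_col u"
  have "\<forall>a. \<exists>P Q. a < ?p \<longrightarrow> P (\<kappa> a) a = 1 \<and> (\<forall>b. a < b \<and> b < ?p \<longrightarrow> P (\<kappa> a) b = 0) \<and>
     (\<forall>t. t + \<kappa> a < ?T \<longrightarrow>
       (\<Sum>s\<le>\<kappa> a. (\<Sum>b<?p. P s b * y $$ (b, t + s)) + (\<Sum>e<?m. Q s e * u $$ (e, t + s))) = 0)"
    using dep unfolding data_dep_def by blast
  then have "\<exists>P Q. \<forall>a. a < ?p \<longrightarrow> P a (\<kappa> a) a = 1 \<and> (\<forall>b. a < b \<and> b < ?p \<longrightarrow> P a (\<kappa> a) b = 0) \<and>
     (\<forall>t. t + \<kappa> a < ?T \<longrightarrow> (\<Sum>s\<le>\<kappa> a.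
       (\<Sum>b<?p. P a s b * y $$ (b, t + s)) + (\<Sum>e<?m. Q a s e * u $$ (e, t + s))) = 0)"
    by (simp only: choice_iff)
  then obtain P Q where rel: "\<forall>a. a < ?p \<longrightarrow> P a (\<kappa> a) a = (1::real) \<and>
     (\<forall>b. a < b \<and> b < ?p \<longrightarrow> P a (\<kappa> a) b = 0) \<and>
     (\<forall>t. t + \<kappa> a < ?T \<longrightarrow> (\<Sum>s\<le>\<kappa> a.
       (\<Sum>b<?p. P a s b * y $$ (b, t + s)) + (\<Sum>e<?m. Q a s e * u $$ (e, t + s))) = 0)"
    by (elim exE)
  have P1: "P a (\<kappa> a) a = 1" if "a < ?p" for a
    using rel[rule_format, OF that] by (elim conjE)
  have P0: "P a (\<kappa> a) b = 0" if "a < b" "b < ?p" for a b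
    using rel[rule_format, of a] that by (meson less_trans)
  have PQ: "(\<Sum>s\<le>\<kappa> a. (\<Sum>b<?p. P a s b * y $$ (b, t + s)) + (\<Sum>e<?m. Q a s e * u $$ (e, t + s))) = 0"
    if "a < ?p" "t + \<kappa> a < ?T" for a t
    by (rule rel[rule_format, OF that(1), THEN conjunct2, THEN conjunct2, rule_format, OF that(2)])
  \<comment> \<open>The contribution of the samples at time \<open>t\<close> to relation
    \<open>a\<close>, with its coefficients at shift \<open>s\<close>.\<close>
  define w where "w a s t = (\<Sum>b<?p. P a s b * y $$ (b, t)) + (\<Sum>e<?m. Q a s e * u $$ (e, t))" for a s t
  define X where "X a r t = cut_state (w a) (\<kappa> a) t r" for a r t
  \<comment> \<open>Pairs start at \<open>r = 1\<close>, as \<open>X a 0\<close> is identically 0;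
    \<open>h\<close> numbers them.\<close>
  define I where "I = (SIGMA a:{..<?p}. {1..\<kappa> a})"
  have "finite I" "card I = n" unfolding I_def n_def by simp_all
  then obtain h where h: "bij_betw h {..<n} I"
    using ex_bij_betw_nat_finite[of I] by (auto simp: atLeast0LessThan)
  define x where "x i = (\<lambda>t. X (fst (h i)) (snd (h i)) t)" for i
  let ?lin = "io_linear ?T n ?m x (\<lambda>e t. u $$ (e, t))"
  have X_lin: "?lin (X a r)" if a: "a < ?p" and r: "r \<le> \<kappa> a" for a r
  proof (cases "r = 0")
    case True
    then show ?thesis by (intro io_linear_cong[OF io_linear_zero]) (simp add: X_def)
  next
    case False
    then have "(a, r) \<in> I" using a r by (auto simp: I_def)
    then obtain i where "i < n" "h i = (a, r)"
      using h by (metis bij_betw_imp_surj_on imageE lessThan_iff)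
    then show ?thesis using io_linear_state[of i n ?T ?m x "\<lambda>e t. u $$ (e, t)"] by (simp add: x_def)
  qed
  have u_lin: "?lin (\<lambda>t. \<Sum>e<?m. c e * u $$ (e, t))" for c
    by (intro io_linear_sum io_linear_scale) (rule io_linear_input[of _ _ _ _ _ "\<lambda>e t. u $$ (e, t)"], simp)
  \<comment> \<open>Outputs are solved for in increasing order: the leading coefficients are 1 on
    the diagonal and 0 above it, so only outputs \<open>b < a\<close> remain.\<close>
  have y_lin: "a < ?p \<Longrightarrow> ?lin (\<lambda>t. y $$ (a, t))" for a
  proof (induction a rule: less_induct)
    case (less a)
    have "?lin (\<lambda>t. X a (\<kappa> a) t - (\<Sum>b<a. P a (\<kappa> a) b * y $$ (b, t)) - (\<Sum>e<?m. Q a (\<kappa> a) e * u $$ (e, t)))"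
      using less by (intro io_linear_diff X_lin u_lin io_linear_sum io_linear_scale) auto
    then show ?case
    proof (rule io_linear_cong)
      fix t assume t: "t < ?T"
      \<comment> \<open>With \<open>r = \<kappa> a\<close> the tail is a single term, available up
        to the end of the data.\<close>
      have "X a (\<kappa> a) t = w a (\<kappa> a) t"
        using cut_state_eq[of "\<kappa> a" ?T "w a" "\<kappa> a" t] PQ[OF less.prems] t
        unfolding X_def w_def by simp
      moreover have "(\<Sum>b<?p. P a (\<kappa> a) b * y $$ (b, t)) = (\<Sum>b<Suc a. P a (\<kappa> a) b * y $$ (b, t))"
        using less.prems P0 by (intro sum.mono_neutral_right) auto
      ultimately show "y $$ (a, t) =
          X a (\<kappa> a) t - (\<Sum>b<a. P a (\<kappa> a) b * y $$ (b, t)) - (\<Sum>e<?m. Q a (\<kappa> a) e * u $$ (e, t))"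
        using P1[OF less.prems] by (simp add: w_def)
    qed
  qed
  have next_lin: "?lin (\<lambda>t. x i (t + 1))" if "i < n" for i
  proof -
    obtain a r where ar: "h i = (a, r)" by fastforce
    then have "(a, r) \<in> I" using h that by (metis bij_betw_apply lessThan_iff)
    then have a: "a < ?p" and r: "0 < r" "r \<le> \<kappa> a" by (auto simp: I_def)
    \<comment> \<open>The recursion of \<open>cut_state\<close>; the current outputs in it are
      eliminated by \<open>y_lin\<close>.\<close>
    have "?lin (\<lambda>t. X a (r - 1) t - ((\<Sum>b<?p. P a (r - 1) b * y $$ (b, t)) + (\<Sum>e<?m. Q a (r - 1) e * u $$ (e, t))))"
      using a r by (intro io_linear_diff io_linear_add X_lin u_lin io_linear_sum io_linear_scale y_lin) auto
    then show ?thesis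
      by (rule io_linear_cong) (use r in \<open>simp add: x_def ar X_def w_def\<close>)
  qed
  have "\<forall>i. \<exists>c d. i < n \<longrightarrow> (\<forall>t<?T. x i (t + 1) = (\<Sum>j<n. c j * x j t) + (\<Sum>e<?m. d e * u $$ (e, t)))"
    using next_lin unfolding io_linear_def by blast
  then obtain cA dB where AB: "\<And>i t. i < n \<Longrightarrow> t < ?T \<Longrightarrow>
      x i (t + 1) = (\<Sum>j<n. cA i j * x j t) + (\<Sum>e<?m. dB i e * u $$ (e, t))"
    unfolding choice_iff by blast
  have "\<forall>a. \<exists>c d. a < ?p \<longrightarrow> (\<forall>t<?T. y $$ (a, t) = (\<Sum>j<n. c j * x j t) + (\<Sum>e<?m. d e * u $$ (e, t)))"
    using y_lin unfolding io_linear_def by blast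
  then obtain cC dD where CD: "\<And>a t. a < ?p \<Longrightarrow> t < ?T \<Longrightarrow>
      y $$ (a, t) = (\<Sum>j<n. cC a j * x j t) + (\<Sum>e<?m. dD a e * u $$ (e, t))"
    unfolding choice_iff by blast
  let ?A = "mat n n (\<lambda>(i, j). cA i j)" and ?B = "mat n ?m (\<lambda>(i, e). dB i e)"
  let ?C = "mat ?p n (\<lambda>(a, j). cC a j)" and ?D = "mat ?p ?m (\<lambda>(a, e). dD a e)"
  let ?x = "mat n (?T + 1) (\<lambda>(i, t). x i t)"
  have "col ?x (t + 1) = ?A *\<^sub>v col ?x t + ?B *\<^sub>v col u t \<and> col y t = ?C *\<^sub>v col ?x t + ?D *\<^sub>v col u t"
    if t: "t < ?T" for t
  proof -
    have "u \<in> carrier_mat ?m ?T" "y \<in> carrier_mat ?p ?T" using uy by auto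
    note entries = trajectory_entries[OF mat_carrier[of n n "\<lambda>(i, j). cA i j"] mat_carrier[of n ?m "\<lambda>(i, e). dB i e"]
        mat_carrier[of ?p n "\<lambda>(a, j). cC a j"] mat_carrier[of ?p ?m "\<lambda>(a, e). dD a e"]
        mat_carrier[of n "?T + 1" "\<lambda>(i, t). x i t"] this t]
    show ?thesis unfolding entries using t AB[OF _ t] CD[OF _ t] by simp
  qed
  then show ?thesis
    by (intro exI[of _ ?A] exI[of _ ?B] exI[of _ ?C] exI[of _ ?D] exI[of _ ?x]) auto
qed

section \<open>Summing the indices and comparing the two sets of systems\<close>

theorem theorem7:
  fixes m p T q :: nat and u y :: "real mat"
  assumes "m \<ge> 1" and "p \<ge> 1" and "T \<ge> 1"
    and "u \<in> carrier_mat m T" and "y \<in> carrier_mat p T"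
    and "u \<noteq> 0\<^sub>m m T"
    and true_system: "\<exists>n M. M \<in> systems m p n \<and> minimal_system m p n M \<and> explains u y n M"
    and q: "q = Min {k \<in> {0..T - 1}. delta u y k = 0}"
  shows "explaining u y (\<Sum>i=0..q. delta u y i) \<noteq> {} \<and>
    explaining u y (\<Sum>i=0..q. delta u y i) = explaining_lag u y q (\<Sum>i=0..q. delta u y i)"
proof -
  have dims [simp]: "dim_row u = m" "dim_col u = T" "dim_row y = p" "dim_col y = T"
    using assms(4,5) by auto
  define N where "N = (\<Sum>i=0..q. delta u y i)"
  have N: "N = (\<Sum>i\<le>q. delta u y i)" by (simp add: N_def atMost_atLeast0)
  have delta: "delta u y k = card {a. a < p \<and> \<not> data_dep u y k a}" if "k < T" for k
    using delta_eq_card[of y u k] that by simp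
  let ?K = "{k \<in> {0..T - 1}. delta u y k = 0}"
  \<comment> \<open>A nonzero input entry makes every output dependent at order
    \<open>T - 1\<close>, so the set under \<open>Min\<close> is not empty.\<close>
  obtain e s where "e < m" "s < T" "u $$ (e, s) \<noteq> 0"
    using assms(4,6) by (metis carrier_matD eq_matI index_zero_mat)
  then have "data_dep u y (T - 1) a" if "a < p" for a
    using data_dep_last[of u e s a y] that by simp
  then have "delta u y (T - 1) = 0" using delta[of "T - 1"] assms(3) by simp
  then have "T - 1 \<in> ?K" by simp
  then have "q \<in> ?K" unfolding q by (intro Min_in) auto
  then have qT: "q < T" and q0: "delta u y q = 0" using assms(3) by auto
  have qmin: "delta u y k \<noteq> 0" if "k < q" for k
  proof
    assume "delta u y k = 0"
    then have "k \<in> ?K" using that qT by simp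
    then have "q \<le> k" unfolding q by (intro Min_le) auto
    then show False using that by simp
  qed
  \<comment> \<open>Each term before index \<open>q\<close> is at least 1. The bound
    \<open>q \<le> N\<close> is what \<open>systems\<close> asks of the lag.\<close>
  have "(\<Sum>i<q. 1) \<le> (\<Sum>i<q. delta u y i)" using qmin by (intro sum_mono) (simp add: Suc_le_eq)
  then have qN: "q \<le> N" unfolding N by (simp add: q0 flip: lessThan_Suc_atMost)
  have dep_q: "data_dep u y q a" if "a < p" for a
    using q0 that unfolding delta[OF qT] by simp
  define \<kappa> where "\<kappa> a = (LEAST k. data_dep u y k a)" for a
  have \<kappa>: "data_dep u y (\<kappa> a) a" "\<kappa> a \<le> q" if "a < p" for a
    unfolding \<kappa>_def using dep_q[OF that] by (auto intro: LeastI Least_le)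
  have dep_iff: "data_dep u y k a \<longleftrightarrow> \<kappa> a \<le> k" if "a < p" for k a
    using \<kappa>(1)[OF that] data_dep_mono unfolding \<kappa>_def by (metis Least_le)
  \<comment> \<open>Double counting of the pairs with \<open>i < \<kappa> a\<close>: for fixed
    \<open>i\<close> there are \<open>delta u y i\<close> of them, for fixed \<open>a\<close> there
    are \<open>\<kappa> a\<close>, since \<open>\<kappa> a \<le> q\<close>.\<close>
  have "N = (\<Sum>i\<le>q. \<Sum>a<p. if i < \<kappa> a then 1 else 0)"
    unfolding N
  proof (intro sum.cong refl)
    fix i assume "i \<in> {..q}"
    then have "delta u y i = card {a. a < p \<and> \<not> data_dep u y i a}" using qT by (simp add: delta)
    also have "{a. a < p \<and> \<not> data_dep u y i a} = {..<p} \<inter> {a. i < \<kappa> a}" using dep_iff by auto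
    finally show "delta u y i = (\<Sum>a<p. if i < \<kappa> a then 1 else 0)" by (simp add: sum.If_cases)
  qed
  also have "\<dots> = (\<Sum>a<p. \<Sum>i\<le>q. if i < \<kappa> a then 1 else 0)" by (rule sum.swap)
  also have "\<dots> = (\<Sum>a<p. \<kappa> a)"
  proof (intro sum.cong refl)
    fix a assume "a \<in> {..<p}"
    then have "{..q} \<inter> {i. i < \<kappa> a} = {..<\<kappa> a}" using \<kappa>(2)[of a] by auto
    then show "(\<Sum>i\<le>q. if i < \<kappa> a then 1 else 0) = \<kappa> a" by (simp add: sum.If_cases)
  qed
  finally have N_sum: "N = (\<Sum>a<p. \<kappa> a)" .
  have lag: "lag C A = q" if "system_blocks m p N M A B C D" "x \<in> carrier_mat N (T + 1)"
    "\<forall>t<T. col x (t + 1) = A *\<^sub>v col x t + B *\<^sub>v col u t \<and> col y t = C *\<^sub>v col x t + D *\<^sub>v col u t"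
    for M A B C D x
    by (rule lag_of_explaining_system[of A N B u C y D x q])
      (use that qT q0 qmin N in \<open>simp_all only: dims system_blocks_def not_False_eq_True\<close>)
  \<comment> \<open>The blocks that witness \<open>explains\<close> also witness membership in
    \<open>systems_lag\<close>, so explaining the data alone decides membership in both
    sets.\<close>
  have to_lag: "M \<in> systems_lag m p q N" if "explains u y N M" for M
    using that lag unfolding explains_def systems_lag_def dims by blast
  then have "M \<in> systems m p N" if "explains u y N M" for M
    using to_lag[OF that] qN unfolding systems_def by auto
  with to_lag have all: "explaining u y N = {M. explains u y N M}"
    "explaining_lag u y q N = {M. explains u y N M}"
    unfolding explaining_def explaining_lag_def by auto
  \<comment> \<open>The realization has as many states as the indices add up to, which is
    \<open>N\<close> by \<open>N_sum\<close>.\<close>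
  have "\<exists>A B C D x. A \<in> carrier_mat N N \<and> B \<in> carrier_mat N m \<and> C \<in> carrier_mat p N \<and>
    D \<in> carrier_mat p m \<and> x \<in> carrier_mat N (T + 1) \<and>
    (\<forall>t<T. col x (t + 1) = A *\<^sub>v col x t + B *\<^sub>v col u t \<and> col y t = C *\<^sub>v col x t + D *\<^sub>v col u t)"
    using explaining_system_exists[of y u \<kappa>] \<kappa>(1) unfolding N_sum by simp
  then have "\<exists>M. explains u y N M"
    unfolding explains_def system_blocks_def dims by blast
  then show ?thesis using all unfolding N_def by auto
qed

end
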